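(* Let $\{X_{t,N};t\in\mathbb{Z}\}$, $N\in\mathbb{N}$, be an array of $p$-dimensional time series satisfying the locally stationary assumption (LS) stated in the context, with constants $\lambda_{\inf},\lambda_{\sup}$ and approximating matrix functions $\{C_r(\cdot)\}_{r\in\mathbb{Z}}$, and let $\mathbf{C}(u)=(C_{t-\tau}(u);t,\tau\in\mathbb{Z})$. Then for all $u\in\mathbb{R}$, $\{C_r(u)\}_{r\in\mathbb{Z}}$ is a positive definite sequence and $$\lambda_{\inf}\le\lambda_{\inf}(\mathbf{C}(u))\le\lambda_{\sup}(\mathbf{C}(u))\le\lambda_{\sup}.$$
   Context: $v(j)=\max(1,|j|)$; $\|\cdot\|_2$ of a matrix is the spectral norm. $\ell_{2,p}$ is the Hilbert space of square-summable sequences $(x_j)_{j\in\mathbb{Z}}$, $x_j\in\mathbb{R}^p$, with $\langle x,y\rangle=\sum_j\langle x_j,y_j\rangle$; block matrices $\mathbf{A}=(A_{t,\tau};t,\tau\in\mathbb{Z})$ act by $(\mathbf{A}x)_t=\sum_\tau A_{t,\tau}x_\tau$, and $\lambda_{\inf}(\mathbf{A})=\inf_{\|x\|_2=1}\langle x,\mathbf{A}x\rangle$, $\lambda_{\sup}(\mathbf{A})=\sup_{\|x\|_2=1}\langle x,\mathbf{A}x\rangle$. For each $N$, $C^{(N)}_{t,\tau}=\mathrm{Cov}[X_{t,N},X_{\tau,N}]$ and $\mathbf{C}^{(N)}=(C^{(N)}_{t,\tau};t,\tau\in\mathbb{Z})$. Assumption (LS), with constants $K<\infty$ and $\kappa>3$: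 (i) there exists $N_0\ge1$ with $0<\lambda_{\inf}\le\inf_{N\ge N_0}\lambda_{\inf}(\mathbf{C}^{(N)})\le\sup_{N\ge N_0}\lambda_{\sup}(\mathbf{C}^{(N)})\le\lambda_{\sup}<\infty$; (ii) for all $N,t,\tau$, $\|C^{(N)}_{t,\tau}\|_2\le K\,v(t-\tau)^{-\kappa}$; (iii) there exist Lipschitz continuous $p\times p$ matrix functions $\{C_r(\cdot),r\in\mathbb{Z}\}$ on $\mathbb{R}$ with $C_r(u)=C_{-r}(u)^\top$, $\sup_u\|C_r(u)\|_2\le K\,v(r)^{-\kappa}$, and $\|C_r(u)-C_r(w)\|_2\le K|u-w|\,v(r)^{-\kappa}$ for all $u,w\in\mathbb{R}$, $r\in\mathbb{Z}$, such that for all $N$, $t$, $\tau$ $$\|C^{(N)}_{t,\tau}-C_{t-\tau}(t/N)\|_2\le\frac{K}{v(t-\tau)^{\kappa-1}}\min\Big(\frac1N,\frac{2}{v(t-\tau)}\Big).$$ *)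

theory Defs
  imports "HOL-Probability.Probability"
begin

subsection \<open>The Hilbert space of square-summable sequences of vectors\<close>

definition l2p :: "(int \<Rightarrow> real ^ 'p) set" where
  "l2p = {x. (\<lambda>j. (norm (x j))\<^sup>2) summable_on UNIV}"

definition l2p_inner :: "(int \<Rightarrow> real ^ 'p) \<Rightarrow> (int \<Rightarrow> real ^ 'p) \<Rightarrow> real" where
  "l2p_inner x y = (\<Sum>\<^sub>\<infinity>j. x j \<bullet> y j)"

definition l2p_norm :: "(int \<Rightarrow> real ^ 'p) \<Rightarrow> real" where
  "l2p_norm x = sqrt (l2p_inner x x)"

definition l2p_sphere :: "(int \<Rightarrow> real ^ 'p) set" where
  "l2p_sphere = {x \<in> l2p. l2p_norm x = 1}"

type_synonym 'p block_matrix = "int \<Rightarrow> int \<Rightarrow> real ^ 'p ^ 'p"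

definition block_apply :: "('p::finite) block_matrix \<Rightarrow> (int \<Rightarrow> real ^ 'p) \<Rightarrow> int \<Rightarrow> real ^ 'p" where
  "block_apply A x = (\<lambda>t. \<Sum>\<^sub>\<infinity>\<tau>. A t \<tau> *v x \<tau>)"

text \<open>Infimum and supremum are taken in \<^typ>\<open>ereal\<close>, so that they are the true ones
  also for unbounded sets of values.\<close>

definition lambda_inf :: "('p::finite) block_matrix \<Rightarrow> ereal" where
  "lambda_inf A = (INF x \<in> l2p_sphere. ereal (l2p_inner x (block_apply A x)))"

definition lambda_sup :: "('p::finite) block_matrix \<Rightarrow> ereal" where
  "lambda_sup A = (SUP x \<in> l2p_sphere. ereal (l2p_inner x (block_apply A x)))"

definition block_toeplitz :: "(int \<Rightarrow> real ^ 'p ^ 'p) \<Rightarrow> ('p::finite) block_matrix" where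
  "block_toeplitz C = (\<lambda>t \<tau>. C (t - \<tau>))"

text \<open>Positive definiteness is meant strictly: every finite section of the symmetric block
  Toeplitz matrix is a positive definite matrix.\<close>

definition positive_definite_sequence :: "(int \<Rightarrow> real ^ 'p ^ 'p) \<Rightarrow> bool" where
  "positive_definite_sequence C \<longleftrightarrow>
     (\<forall>r. C (- r) = transpose (C r)) \<and>
     (\<forall>S (x :: int \<Rightarrow> real ^ 'p). finite S \<longrightarrow> (\<exists>t\<in>S. x t \<noteq> 0) \<longrightarrow>
        (\<Sum>t\<in>S. \<Sum>\<tau>\<in>S. x t \<bullet> (C (t - \<tau>) *v x \<tau>)) > 0)"


subsection \<open>Covariances\<close>

text \<open>The norm of the type of matrices is the Frobenius norm; the spectral norm is the operator
  norm for the Euclidean norm.\<close>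

definition spectral_norm :: "real ^ 'n ^ 'm \<Rightarrow> real" where
  "spectral_norm A = onorm (\<lambda>x. A *v x)"

definition vlag :: "int \<Rightarrow> real" where
  "vlag j = max 1 (real_of_int \<bar>j\<bar>)"

definition second_order :: "'w measure \<Rightarrow> ('w \<Rightarrow> real ^ 'p) \<Rightarrow> bool" where
  "second_order M Y \<longleftrightarrow>
     Y \<in> borel_measurable M \<and> integrable M (\<lambda>\<omega>. (norm (Y \<omega>))\<^sup>2)"

definition cov_matrix :: "'w measure \<Rightarrow> ('w \<Rightarrow> real ^ 'p) \<Rightarrow> ('w \<Rightarrow> real ^ 'p) \<Rightarrow> real ^ 'p ^ 'p" where
  "cov_matrix M Y Z = (\<chi> i j. \<integral>\<omega>.
     (Y \<omega> $ i - (\<integral>\<omega>'. Y \<omega>' $ i \<partial>M)) * (Z \<omega> $ j - (\<integral>\<omega>'. Z \<omega>' $ j \<partial>M)) \<partial>M)"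

text \<open>\<open>X t N\<close> is the \<open>t\<close>-th entry of the \<open>N\<close>-th series. Covariances only involve
  variables of the same series, so every series may live on its own probability space.\<close>

definition cov_block ::
    "(nat \<Rightarrow> 'w measure) \<Rightarrow> (int \<Rightarrow> nat \<Rightarrow> 'w \<Rightarrow> real ^ 'p) \<Rightarrow> nat \<Rightarrow> ('p::finite) block_matrix" where
  "cov_block M X N = (\<lambda>t \<tau>. cov_matrix (M N) (X t N) (X \<tau> N))"

definition time_series_array ::
    "(nat \<Rightarrow> 'w measure) \<Rightarrow> (int \<Rightarrow> nat \<Rightarrow> 'w \<Rightarrow> real ^ 'p) \<Rightarrow> bool" where
  "time_series_array M X \<longleftrightarrow>
     (\<forall>N\<ge>1. prob_space (M N) \<and> (\<forall>t. second_order (M N) (X t N)))"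


subsection \<open>Local stationarity\<close>

text \<open>The series are indexed by \<open>N \<ge> 1\<close>.\<close>

definition locally_stationary ::
    "(nat \<Rightarrow> 'w measure) \<Rightarrow> (int \<Rightarrow> nat \<Rightarrow> 'w \<Rightarrow> real ^ 'p) \<Rightarrow> real \<Rightarrow> real \<Rightarrow> real \<Rightarrow> real \<Rightarrow>
     (int \<Rightarrow> real \<Rightarrow> real ^ 'p ^ 'p) \<Rightarrow> bool" where
  "locally_stationary M X K \<kappa> lam_inf lam_sup C \<longleftrightarrow>
     \<kappa> > 3 \<and>
     0 < lam_inf \<and>
     (\<exists>N0\<ge>1.
        ereal lam_inf \<le> (INF N\<in>{N0..}. lambda_inf (cov_block M X N)) \<and>
        (INF N\<in>{N0..}. lambda_inf (cov_block M X N))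
          \<le> (SUP N\<in>{N0..}. lambda_sup (cov_block M X N)) \<and>
        (SUP N\<in>{N0..}. lambda_sup (cov_block M X N)) \<le> ereal lam_sup) \<and>
     (\<forall>N\<ge>1. \<forall>t \<tau>. spectral_norm (cov_block M X N t \<tau>) \<le> K * vlag (t - \<tau>) powr (- \<kappa>)) \<and>
     (\<forall>r. \<exists>L. L-lipschitz_on UNIV (C r)) \<and>
     (\<forall>r u. C r u = transpose (C (- r) u)) \<and>
     (\<forall>r. (SUP u. ereal (spectral_norm (C r u))) \<le> ereal (K * vlag r powr (- \<kappa>))) \<and>
     (\<forall>r u w. spectral_norm (C r u - C r w) \<le> K * \<bar>u - w\<bar> * vlag r powr (- \<kappa>)) \<and>
     (\<forall>N\<ge>1. \<forall>t \<tau>.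
        spectral_norm (cov_block M X N t \<tau> - C (t - \<tau>) (real_of_int t / real N))
          \<le> K / vlag (t - \<tau>) powr (\<kappa> - 1) * min (1 / real N) (2 / vlag (t - \<tau>)))"

end

theory Submission
  imports Defs
begin

text \<open>
  A quadratic form of \<open>\<^bold>C(u)\<close> at a finitely supported \<open>x\<close> only involves finitely many blocks.
  By local stationarity and Lipschitz continuity, \<open>C\<^sub>t\<^sub>-\<^sub>\<tau>(u)\<close> is the limit of the blocks
  of \<open>\<^bold>C\<close> for the \<open>N\<close>-th series at the indices \<open>t + \<lfloor>uN\<rfloor>\<close>, \<open>\<tau> + \<lfloor>uN\<rfloor>\<close>,
  and translating the support of \<open>x\<close> does not change its norm. So the spectral bounds for
  the \<open>N\<close>-th series pass to finite sections of \<open>\<^bold>C(u)\<close>. Since the blocks are dominated by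
  a summable function of the lag, the form at an arbitrary square-summable sequence is the
  limit of the forms at its finite truncations.
\<close>

section \<open>Quadratic forms on finite sections\<close>

lemma infsum_eq_sum_of_support:
  fixes f :: "'a \<Rightarrow> 'b::{comm_monoid_add,t2_space}"
  assumes "finite S" and "\<forall>t\<in>- S. f t = 0"
  shows "infsum f UNIV = sum f S"
proof -
  have "infsum f UNIV = infsum f S"
    by (rule infsum_cong_neutral) (use assms(2) in auto)
  then show ?thesis
    using assms(1) by simp
qed

lemma l2p_finite_support:
  fixes x :: "int \<Rightarrow> real ^ 'p"
  assumes "finite S" and "\<forall>t\<in>- S. x t = 0"
  shows "x \<in> l2p" and "l2p_inner x y = (\<Sum>t\<in>S. x t \<bullet> y t)"
proof -
  have "(\<lambda>t. (norm (x t))\<^sup>2) summable_on UNIV \<longleftrightarrow> (\<lambda>t. (norm (x t))\<^sup>2) summable_on S"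
    by (rule summable_on_cong_neutral) (use assms(2) in auto)
  then show "x \<in> l2p"
    using assms(1) by (simp add: l2p_def)
  show "l2p_inner x y = (\<Sum>t\<in>S. x t \<bullet> y t)"
    unfolding l2p_inner_def
    by (rule infsum_eq_sum_of_support) (use assms in auto)
qed

lemma l2p_form_finite_support:
  fixes A :: "('p::finite) block_matrix"
  assumes "finite S" and "\<forall>t\<in>- S. x t = 0"
  shows "l2p_inner x (block_apply A x) = (\<Sum>t\<in>S. \<Sum>\<tau>\<in>S. x t \<bullet> (A t \<tau> *v x \<tau>))"
proof -
  have "block_apply A x t = (\<Sum>\<tau>\<in>S. A t \<tau> *v x \<tau>)" for t
    unfolding block_apply_def
    by (rule infsum_eq_sum_of_support) (use assms in auto)
  then show ?thesis
    by (simp add: l2p_finite_support(2)[OF assms] inner_sum_right)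
qed

text \<open>Truncating \<open>x\<close> to \<open>S\<close> and dividing by the root of its squared
  norm gives a unit vector, and the form is homogeneous of degree two. This links finite sums to the
  unit sphere over which \<open>lambda_inf\<close> and \<open>lambda_sup\<close> are taken.\<close>

lemma finite_section_normalized:
  fixes A :: "('p::finite) block_matrix" and x :: "int \<Rightarrow> real ^ 'p"
  assumes "finite S" and pos: "(\<Sum>t\<in>S. (norm (x t))\<^sup>2) > 0"
  obtains y where "y \<in> l2p_sphere"
    and "(\<Sum>t\<in>S. \<Sum>\<tau>\<in>S. x t \<bullet> (A t \<tau> *v x \<tau>))
           = (\<Sum>t\<in>S. (norm (x t))\<^sup>2) * l2p_inner y (block_apply A y)"
proof
  define q where "q = (\<Sum>t\<in>S. (norm (x t))\<^sup>2)"
  define y where "y = (\<lambda>t. if t \<in> S then (1 / sqrt q) *\<^sub>R x t else 0)"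
  have q: "q > 0"
    using pos by (simp add: q_def)
  then have sq: "sqrt q * sqrt q = q"
    by simp
  have y0: "\<forall>t\<in>- S. y t = 0"
    by (simp add: y_def)
  have "l2p_inner y y = (\<Sum>t\<in>S. (norm (x t))\<^sup>2 / q)"
    unfolding l2p_finite_support(2)[OF assms(1) y0]
    by (rule sum.cong) (use q in \<open>auto simp: y_def sq power2_norm_eq_inner\<close>)
  also have "\<dots> = 1"
    using q by (simp add: q_def flip: sum_divide_distrib)
  finally show "y \<in> l2p_sphere"
    by (simp add: l2p_sphere_def l2p_norm_def l2p_finite_support(1)[OF assms(1) y0])
  have "l2p_inner y (block_apply A y) = (\<Sum>t\<in>S. \<Sum>\<tau>\<in>S. x t \<bullet> (A t \<tau> *v x \<tau>) / q)"
    unfolding l2p_form_finite_support[OF assms(1) y0]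
    by (intro sum.cong) (use q in \<open>auto simp: y_def sq matrix_vector_mult_scaleR\<close>)
  also have "\<dots> = (\<Sum>t\<in>S. \<Sum>\<tau>\<in>S. x t \<bullet> (A t \<tau> *v x \<tau>)) / q"
    by (simp flip: sum_divide_distrib)
  finally show "(\<Sum>t\<in>S. \<Sum>\<tau>\<in>S. x t \<bullet> (A t \<tau> *v x \<tau>))
           = (\<Sum>t\<in>S. (norm (x t))\<^sup>2) * l2p_inner y (block_apply A y)"
    using q by (simp flip: q_def)
qed

text \<open>By homogeneity, the bounds on the unit sphere scale with the squared norm of
  \<open>x\<close> on \<open>S\<close>. If that norm is zero, normalization is impossible, but then
  \<open>x\<close> vanishes on \<open>S\<close> and all terms are zero.\<close>

lemma finite_section_bounds:
  fixes A :: "('p::finite) block_matrix" and x :: "int \<Rightarrow> real ^ 'p"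
  assumes "ereal l \<le> lambda_inf A" and "lambda_sup A \<le> ereal m" and "finite S"
  shows "l * (\<Sum>t\<in>S. (norm (x t))\<^sup>2) \<le> (\<Sum>t\<in>S. \<Sum>\<tau>\<in>S. x t \<bullet> (A t \<tau> *v x \<tau>))"
    and "(\<Sum>t\<in>S. \<Sum>\<tau>\<in>S. x t \<bullet> (A t \<tau> *v x \<tau>)) \<le> m * (\<Sum>t\<in>S. (norm (x t))\<^sup>2)"
proof -
  let ?q = "\<Sum>t\<in>S. (norm (x t))\<^sup>2"
  let ?f = "\<Sum>t\<in>S. \<Sum>\<tau>\<in>S. x t \<bullet> (A t \<tau> *v x \<tau>)"
  have "l * ?q \<le> ?f \<and> ?f \<le> m * ?q"
  proof (cases "?q = 0")
    case True
    then have "\<forall>t\<in>S. x t = 0"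
      using assms(3) by (simp add: sum_nonneg_eq_0_iff)
    then show ?thesis
      by simp
  next
    case False
    then have q: "?q > 0"
      by (simp add: order_less_le sum_nonneg)
    obtain y where y: "y \<in> l2p_sphere" and f: "?f = ?q * l2p_inner y (block_apply A y)"
      by (rule finite_section_normalized[OF assms(3) q])
    have "ereal l \<le> ereal (l2p_inner y (block_apply A y))"
      using order_trans[OF assms(1)[unfolded lambda_inf_def] INF_lower[OF y]] .
    moreover have "ereal (l2p_inner y (block_apply A y)) \<le> ereal m"
      using order_trans[OF SUP_upper[OF y] assms(2)[unfolded lambda_sup_def]] .
    ultimately show ?thesis
      using q f by (simp add: mult.commute[of _ ?q])
  qed
  then show "l * ?q \<le> ?f" and "?f \<le> m * ?q"
    by auto
qed

text \<open>The shift is moved from the matrix to the vector: the sums are those of \<open>A\<close>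
  itself over the translate of \<open>S\<close>, at the translated \<open>x\<close>. The bounds do
  not depend on \<open>s\<close>, so later the shift may vary with \<open>N\<close>.\<close>

lemma translated_section_bounds:
  fixes A :: "('p::finite) block_matrix" and x :: "int \<Rightarrow> real ^ 'p"
  assumes "ereal l \<le> lambda_inf A" and "lambda_sup A \<le> ereal m" and "finite S"
  shows "l * (\<Sum>t\<in>S. (norm (x t))\<^sup>2) \<le> (\<Sum>t\<in>S. \<Sum>\<tau>\<in>S. x t \<bullet> (A (t + s) (\<tau> + s) *v x \<tau>))"
    and "(\<Sum>t\<in>S. \<Sum>\<tau>\<in>S. x t \<bullet> (A (t + s) (\<tau> + s) *v x \<tau>)) \<le> m * (\<Sum>t\<in>S. (norm (x t))\<^sup>2)"
  using finite_section_bounds[OF assms(1,2), of "(\<lambda>t. t + s) ` S" "\<lambda>t. x (t - s)"] assms(3)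
  by (simp_all add: sum.reindex)

section \<open>Summability of forms whose blocks are dominated by a function of the lag\<close>

lemma norm_matrix_vector_le_spectral_norm:
  "norm (A *v v) \<le> spectral_norm A * norm v"
  unfolding spectral_norm_def by (intro onorm) simp

lemma summable_on_vlag_powr:
  assumes "\<kappa> > 1"
  shows "(\<lambda>r. vlag r powr (- \<kappa>)) summable_on UNIV"
proof -
  let ?f = "\<lambda>r. vlag r powr (- \<kappa>)"
  have "summable (\<lambda>n. real n powr (- \<kappa>))"
    using assms by (simp add: summable_real_powr_iff)
  \<comment> \<open>The two terms differ at \<open>n = 0\<close>, where
    \<open>0 powr (- \<kappa>)\<close> is 0 by convention while \<open>vlag 0 = 1\<close>.\<close>
  moreover have "\<forall>\<^sub>F n in sequentially. real n powr (- \<kappa>) = ?f (int n)"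
    using eventually_ge_at_top[of "1::nat"] by eventually_elim (simp add: vlag_def max_def)
  ultimately have nat: "summable (\<lambda>n. ?f (int n))"
    using summable_cong by fastforce
  then have "(\<lambda>n. ?f (int n)) summable_on UNIV"
    by (simp add: summable_on_UNIV_nonneg_real_iff)
  then have nonneg: "?f summable_on {0..}"
    by (subst summable_on_reindex_bij_witness[where i = int and j = nat and T = UNIV
          and h = "\<lambda>n. ?f (int n)"]) auto
  from nat have "summable (\<lambda>n. ?f (int (Suc n)))"
    by (subst summable_Suc_iff)
  then have "(\<lambda>n. ?f (int (Suc n))) summable_on UNIV"
    by (simp add: summable_on_UNIV_nonneg_real_iff)
  \<comment> \<open>The negative half-line is enumerated from -1 downwards, so its series is the
    nonnegative one without the term at 0.\<close>
  moreover have "vlag (- 1 - int n) = vlag (int (Suc n))" for n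
    by (simp add: vlag_def)
  ultimately have neg: "?f summable_on {..<0}"
    by (subst summable_on_reindex_bij_witness[where i = "\<lambda>n. - int (Suc n)"
          and j = "\<lambda>r. nat (- r - 1)" and T = UNIV and h = "\<lambda>n. ?f (int (Suc n))"])
      (auto simp: vlag_def)
  have "?f summable_on ({0..} \<union> {..<0})"
    by (intro summable_on_Un_disjoint nonneg neg) auto
  moreover have "{0..} \<union> {..<0} = (UNIV :: int set)"
    by auto
  ultimately show ?thesis
    by simp
qed

text \<open>A Schur test: each entry is at most \<open>k (t - \<tau>)\<close> times the sum of the
  squared norms of \<open>x t\<close> and \<open>x \<tau>\<close>, and \<open>k\<close> has the same
  total along every row and every column. The double family is thus absolutely summable, so the
  iterated sum defining the form can be evaluated in any order, in particular along growing
  squares.\<close>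

lemma l2p_form_has_sum:
  fixes A :: "('p::finite) block_matrix" and x :: "int \<Rightarrow> real ^ 'p"
  assumes k: "k summable_on UNIV"
    and A: "\<And>t \<tau> v. norm (A t \<tau> *v v) \<le> k (t - \<tau>) * norm v"
    and x: "x \<in> l2p"
  shows "((\<lambda>(t, \<tau>). x t \<bullet> (A t \<tau> *v x \<tau>)) has_sum l2p_inner x (block_apply A x)) (UNIV \<times> UNIV)"
proof -
  \<comment> \<open>The sign of \<open>k\<close> is read off from the norm bound at a unit
    vector.\<close>
  have k0: "k r \<ge> 0" for r
  proof -
    obtain v :: "real ^ 'p" where v: "norm v = 1"
      using vector_choose_size[of 1] by auto
    show ?thesis
      using order_trans[OF norm_ge_zero A[of r 0 v]] v by simp
  qed
  have krefl: "(\<lambda>\<tau>. k (t - \<tau>)) summable_on UNIV" for t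
    using k by (subst summable_on_reindex_bij_witness[where i = "\<lambda>r. t - r" and j = "\<lambda>r. t - r"
          and T = UNIV and h = k]) auto
  have kshift: "(\<lambda>t. k (t - \<tau>)) summable_on UNIV" for \<tau>
    using k by (subst summable_on_reindex_bij_witness[where i = "\<lambda>r. r + \<tau>" and j = "\<lambda>r. r - \<tau>"
          and T = UNIV and h = k]) auto
  have krefl_sum: "(\<Sum>\<^sub>\<infinity>\<tau>. k (t - \<tau>)) = infsum k UNIV" for t
    by (rule infsum_reindex_bij_witness[where i = "\<lambda>r. t - r" and j = "\<lambda>r. t - r"]) auto
  have kshift_sum: "(\<Sum>\<^sub>\<infinity>t. k (t - \<tau>)) = infsum k UNIV" for \<tau>
    by (rule infsum_reindex_bij_witness[where i = "\<lambda>r. r + \<tau>" and j = "\<lambda>r. r - \<tau>"]) auto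
  have krefl_has_sum: "((\<lambda>\<tau>. k (t - \<tau>)) has_sum infsum k UNIV) UNIV" for t
    using has_sum_infsum[OF krefl[of t]] by (simp add: krefl_sum)
  have kshift_has_sum: "((\<lambda>t. k (t - \<tau>)) has_sum infsum k UNIV) UNIV" for \<tau>
    using has_sum_infsum[OF kshift[of \<tau>]] by (simp add: kshift_sum)
  have x2: "(\<lambda>t. (norm (x t))\<^sup>2) summable_on UNIV"
    using x by (simp add: l2p_def)
  have row: "(\<lambda>(t, \<tau>). (norm (x t))\<^sup>2 * k (t - \<tau>)) summable_on UNIV \<times> UNIV"
    by (rule summable_on_SigmaI[where g = "\<lambda>t. (norm (x t))\<^sup>2 * infsum k UNIV"])
      (auto intro!: has_sum_cmult_right krefl_has_sum summable_on_cmult_left x2 mult_nonneg_nonneg k0)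
  \<comment> \<open>The inner sum must run over \<open>t\<close> here, so the pair is written in the
    order \<open>(\<tau>, t)\<close> and swapped afterwards.\<close>
  have "(\<lambda>(\<tau>, t). (norm (x \<tau>))\<^sup>2 * k (t - \<tau>)) summable_on UNIV \<times> UNIV"
    by (rule summable_on_SigmaI[where g = "\<lambda>t. (norm (x t))\<^sup>2 * infsum k UNIV"])
      (auto intro!: has_sum_cmult_right kshift_has_sum summable_on_cmult_left x2 mult_nonneg_nonneg k0)
  then have col: "(\<lambda>(t, \<tau>). (norm (x \<tau>))\<^sup>2 * k (t - \<tau>)) summable_on UNIV \<times> UNIV"
    by (subst summable_on_reindex_bij_witness[where i = prod.swap and j = prod.swap
          and T = "UNIV \<times> UNIV" and h = "\<lambda>(\<tau>, t). (norm (x \<tau>))\<^sup>2 * k (t - \<tau>)"]) auto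
  have entry: "norm (x t \<bullet> (A t \<tau> *v x \<tau>))
      \<le> (norm (x t))\<^sup>2 * k (t - \<tau>) + (norm (x \<tau>))\<^sup>2 * k (t - \<tau>)" for t \<tau>
  proof -
    have "norm (x t \<bullet> (A t \<tau> *v x \<tau>)) \<le> norm (x t) * norm (A t \<tau> *v x \<tau>)"
      by (simp add: Cauchy_Schwarz_ineq2)
    also have "\<dots> \<le> norm (x t) * (k (t - \<tau>) * norm (x \<tau>))"
      by (intro mult_left_mono A) auto
    also have "\<dots> = (norm (x t) * norm (x \<tau>)) * k (t - \<tau>)"
      by simp
    also have "\<dots> \<le> ((norm (x t))\<^sup>2 + (norm (x \<tau>))\<^sup>2) * k (t - \<tau>)"
    proof (intro mult_right_mono k0)
      have "2 * norm (x t) * norm (x \<tau>) \<le> (norm (x t))\<^sup>2 + (norm (x \<tau>))\<^sup>2"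
        by (rule sum_squares_bound)
      moreover have "norm (x t) * norm (x \<tau>) \<ge> 0"
        by simp
      ultimately show "norm (x t) * norm (x \<tau>) \<le> (norm (x t))\<^sup>2 + (norm (x \<tau>))\<^sup>2"
        by linarith
    qed
    finally show ?thesis
      by (simp add: algebra_simps)
  qed
  let ?f = "\<lambda>(t, \<tau>). x t \<bullet> (A t \<tau> *v x \<tau>)"
  have "(\<lambda>p. norm (?f p)) summable_on UNIV \<times> UNIV"
    by (rule Infinite_Sum.abs_summable_on_comparison_test'[OF summable_on_add[OF row col]])
      (use entry in auto)
  then have summ: "?f summable_on UNIV \<times> UNIV"
    by (rule Infinite_Sum.abs_summable_summable)
  \<comment> \<open>\<open>block_apply\<close> is an \<open>infsum\<close>, which would be 0 for a
    divergent row, so convergence of each row has to be shown. The first power of the norm of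
    \<open>x \<tau>\<close> is absorbed by 1 plus its square; the two resulting parts are a
    reflected copy of \<open>k\<close> and a slice of \<open>col\<close>.\<close>
  have Ax: "(\<lambda>\<tau>. A t \<tau> *v x \<tau>) summable_on UNIV" for t
  proof (rule Infinite_Sum.abs_summable_summable, rule Infinite_Sum.abs_summable_on_comparison_test')
    show "(\<lambda>\<tau>. k (t - \<tau>) + (norm (x \<tau>))\<^sup>2 * k (t - \<tau>)) summable_on UNIV"
      using summable_on_SigmaD1[OF col, of t] by (intro summable_on_add krefl) simp
  next
    fix \<tau>
    have "norm (x \<tau>) \<le> 1 + (norm (x \<tau>))\<^sup>2"
      using sum_squares_bound[of 1 "norm (x \<tau>)"] norm_ge_zero[of "x \<tau>"]
      unfolding power_one mult_1_right by linarith
    then have "k (t - \<tau>) * norm (x \<tau>) \<le> k (t - \<tau>) * (1 + (norm (x \<tau>))\<^sup>2)"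
      by (intro mult_left_mono k0)
    then show "norm (A t \<tau> *v x \<tau>) \<le> k (t - \<tau>) + (norm (x \<tau>))\<^sup>2 * k (t - \<tau>)"
      using A[of t \<tau> "x \<tau>"] by (simp add: algebra_simps)
  qed
  have rows: "((\<lambda>\<tau>. ?f (t, \<tau>)) has_sum x t \<bullet> block_apply A x t) UNIV" for t
    using has_sum_bounded_linear[OF bounded_linear_inner_right has_sum_infsum[OF Ax[of t]], of "x t"]
    by (simp add: block_apply_def)
  have "((\<lambda>t. x t \<bullet> block_apply A x t) has_sum infsum ?f (UNIV \<times> UNIV)) UNIV"
    by (rule has_sum_SigmaD[OF has_sum_infsum[OF summ] rows])
  then have "l2p_inner x (block_apply A x) = infsum ?f (UNIV \<times> UNIV)"
    unfolding l2p_inner_def by (rule infsumI)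
  then show ?thesis
    using has_sum_infsum[OF summ] by simp
qed

text \<open>A finite set of index pairs lies in the square of the union of its two projections, so
  squares are cofinal. An unordered double sum is therefore the limit of its square partial sums,
  which are the finite sections.\<close>

lemma filterlim_square_finite_subsets_at_top:
  "filterlim (\<lambda>S. S \<times> S) (finite_subsets_at_top (UNIV \<times> UNIV)) (finite_subsets_at_top UNIV)"
  unfolding filterlim_finite_subsets_at_top
proof safe
  fix P :: "('a \<times> 'a) set"
  assume "finite P"
  then have "finite (fst ` P \<union> snd ` P)"
    by simp
  then have "\<forall>\<^sub>F S in finite_subsets_at_top UNIV. finite S \<and> fst ` P \<union> snd ` P \<subseteq> S"
    by (auto simp: eventually_finite_subsets_at_top)
  then show "\<forall>\<^sub>F S in finite_subsets_at_top UNIV. finite (S \<times> S) \<and> P \<subseteq> S \<times> S \<and> S \<times> S \<subseteq> UNIV \<times> UNIV"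
    by eventually_elim force
qed

lemma l2p_sphere_has_sum:
  assumes "x \<in> l2p_sphere"
  shows "((\<lambda>t. (norm (x t))\<^sup>2) has_sum 1) UNIV"
proof -
  have "(\<Sum>\<^sub>\<infinity>t. (norm (x t))\<^sup>2) = 1"
    using assms by (simp add: l2p_sphere_def l2p_norm_def l2p_inner_def power2_norm_eq_inner)
  moreover have "(\<lambda>t. (norm (x t))\<^sup>2) summable_on UNIV"
    using assms by (simp add: l2p_sphere_def l2p_def)
  ultimately show ?thesis
    using has_sum_infsum by fastforce
qed

text \<open>At a unit vector \<open>x\<close>, the sums over \<open>S\<close> converge to the full
  form while the squared norm on \<open>S\<close> tends to 1. The section inequalities carry this
  norm as a factor, so they pass to the limit without renormalizing the truncations.\<close>

lemma lambda_bounds_of_finite_sections: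
  fixes A :: "('p::finite) block_matrix"
  assumes k: "k summable_on UNIV"
    and A: "\<And>t \<tau> v. norm (A t \<tau> *v v) \<le> k (t - \<tau>) * norm v"
    and l: "\<And>S x. finite S \<Longrightarrow>
      l * (\<Sum>t\<in>S. (norm (x t))\<^sup>2) \<le> (\<Sum>t\<in>S. \<Sum>\<tau>\<in>S. x t \<bullet> (A t \<tau> *v x \<tau>))"
    and m: "\<And>S x. finite S \<Longrightarrow>
      (\<Sum>t\<in>S. \<Sum>\<tau>\<in>S. x t \<bullet> (A t \<tau> *v x \<tau>)) \<le> m * (\<Sum>t\<in>S. (norm (x t))\<^sup>2)"
  shows "ereal l \<le> lambda_inf A" and "lambda_sup A \<le> ereal m"
proof -
  have "l \<le> l2p_inner x (block_apply A x) \<and> l2p_inner x (block_apply A x) \<le> m"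
    if x: "x \<in> l2p_sphere" for x
  proof -
    let ?F = "finite_subsets_at_top (UNIV :: int set)"
    have q: "((\<lambda>S. \<Sum>t\<in>S. (norm (x t))\<^sup>2) \<longlongrightarrow> 1) ?F"
      using l2p_sphere_has_sum[OF x] unfolding has_sum_def .
    have lq: "((\<lambda>S. c * (\<Sum>t\<in>S. (norm (x t))\<^sup>2)) \<longlongrightarrow> c) ?F" for c
      using tendsto_mult_left[OF q, of c] by simp
    have "x \<in> l2p"
      using x by (simp add: l2p_sphere_def)
    then have "(sum (\<lambda>(t, \<tau>). x t \<bullet> (A t \<tau> *v x \<tau>)) \<longlongrightarrow> l2p_inner x (block_apply A x))
        (finite_subsets_at_top (UNIV \<times> UNIV))"
      using l2p_form_has_sum[OF k, of A x] A unfolding has_sum_def by blast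
    from filterlim_compose[OF this filterlim_square_finite_subsets_at_top]
    have f: "((\<lambda>S. \<Sum>t\<in>S. \<Sum>\<tau>\<in>S. x t \<bullet> (A t \<tau> *v x \<tau>)) \<longlongrightarrow> l2p_inner x (block_apply A x)) ?F"
      by (simp add: sum.cartesian_product)
    have "l \<le> l2p_inner x (block_apply A x)"
      by (rule tendsto_le[OF _ f lq]) (auto intro: eventually_finite_subsets_at_top_weakI l)
    moreover have "l2p_inner x (block_apply A x) \<le> m"
      by (rule tendsto_le[OF _ lq f]) (auto intro: eventually_finite_subsets_at_top_weakI m)
    ultimately show ?thesis ..
  qed
  then show "ereal l \<le> lambda_inf A" and "lambda_sup A \<le> ereal m"
    unfolding lambda_inf_def lambda_sup_def by (auto intro: INF_greatest SUP_least)
qed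

text \<open>The point is that the unit sphere is nonempty; over an empty set the infimum would be
  \<infinity> and the supremum -\<infinity>. A unit vector placed at index 0 is a witness.\<close>

lemma lambda_inf_le_lambda_sup:
  fixes A :: "('p::finite) block_matrix"
  shows "lambda_inf A \<le> lambda_sup A"
proof -
  obtain v :: "real ^ 'p" where v: "norm v = 1"
    using vector_choose_size[of 1] by auto
  obtain y :: "int \<Rightarrow> real ^ 'p" where "y \<in> l2p_sphere"
    by (rule finite_section_normalized[of "{0}" "\<lambda>_. v"]) (simp_all add: v)
  then show ?thesis
    unfolding lambda_inf_def lambda_sup_def by (intro INF_le_SUP) auto
qed

section \<open>Convergence of covariance blocks under local stationarity\<close>

lemma tendsto_shifted_rescaled_index:
  "(\<lambda>N. real_of_int (t + \<lfloor>u * real N\<rfloor>) / real N) \<longlonglongrightarrow> u"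
proof (rule Lim_transform2)
  \<comment> \<open>The comparison sequence omits the rounding. What remains is the fractional part
    of \<open>u * real N\<close> divided by \<open>N\<close>, at most
    \<open>1 / real N\<close>.\<close>
  show "(\<lambda>N. real_of_int t / real N + u) \<longlonglongrightarrow> u"
    by (intro tendsto_eq_intros lim_const_over_n) auto
  have "\<forall>\<^sub>F N in sequentially.
      norm (real_of_int t / real N + u - real_of_int (t + \<lfloor>u * real N\<rfloor>) / real N) \<le> 1 / real N"
    using eventually_gt_at_top[of "0::nat"]
  proof eventually_elim
    case (elim N)
    then have "real_of_int t / real N + u - real_of_int (t + \<lfloor>u * real N\<rfloor>) / real N
        = (u * real N - real_of_int \<lfloor>u * real N\<rfloor>) / real N"
      by (simp add: field_simps)
    moreover have "\<bar>u * real N - real_of_int \<lfloor>u * real N\<rfloor>\<bar> \<le> 1"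
      by linarith
    ultimately show ?case
      by (simp add: divide_right_mono)
  qed
  then show "(\<lambda>N. real_of_int t / real N + u - real_of_int (t + \<lfloor>u * real N\<rfloor>) / real N) \<longlonglongrightarrow> 0"
    by (rule Lim_null_comparison) (rule lim_1_over_n)
qed

text \<open>The common shift leaves the lag \<open>t - \<tau>\<close> unchanged and brings the
  rescaled time \<open>?w N\<close> to \<open>u\<close>. The triangle inequality through
  \<open>C (t - \<tau>) (?w N)\<close> splits the error into the local stationarity error and the
  Lipschitz error. Applying the blocks to a vector lets the spectral norm bounds act directly on
  Euclidean norms.\<close>

lemma locally_stationary_tendsto:
  fixes C :: "int \<Rightarrow> real \<Rightarrow> real ^ 'p ^ 'p"
  assumes "locally_stationary M X K \<kappa> lam_inf lam_sup C"
  shows "(\<lambda>N. cov_block M X N (t + \<lfloor>u * real N\<rfloor>) (\<tau> + \<lfloor>u * real N\<rfloor>) *v v)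
    \<longlonglongrightarrow> C (t - \<tau>) u *v v"
proof (rule LIM_zero_cancel)
  let ?w = "\<lambda>N. real_of_int (t + \<lfloor>u * real N\<rfloor>) / real N"
  let ?c = "vlag (t - \<tau>)"
  let ?B = "\<lambda>N. cov_block M X N (t + \<lfloor>u * real N\<rfloor>) (\<tau> + \<lfloor>u * real N\<rfloor>)"
  let ?b = "\<lambda>N. (K / ?c powr (\<kappa> - 1) * min (1 / real N) (2 / ?c)
      + K * \<bar>?w N - u\<bar> * ?c powr (- \<kappa>)) * norm v"
  have "\<forall>\<^sub>F N in sequentially. norm (?B N *v v - C (t - \<tau>) u *v v) \<le> ?b N"
    using eventually_ge_at_top[of "1::nat"]
  proof eventually_elim
    case (elim N)
    have "spectral_norm (?B N - C (t - \<tau>) (?w N))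
        \<le> K / ?c powr (\<kappa> - 1) * min (1 / real N) (2 / ?c)"
    proof -
      have "\<forall>t \<tau>. spectral_norm (cov_block M X N t \<tau> - C (t - \<tau>) (real_of_int t / real N))
          \<le> K / vlag (t - \<tau>) powr (\<kappa> - 1) * min (1 / real N) (2 / vlag (t - \<tau>))"
        using assms elim unfolding locally_stationary_def by blast
      from this[rule_format, of "t + \<lfloor>u * real N\<rfloor>" "\<tau> + \<lfloor>u * real N\<rfloor>"] show ?thesis
        by simp
    qed
    moreover have "spectral_norm (C (t - \<tau>) (?w N) - C (t - \<tau>) u)
        \<le> K * \<bar>?w N - u\<bar> * ?c powr (- \<kappa>)"
      using assms unfolding locally_stationary_def by blast
    moreover have "norm (?B N *v v - C (t - \<tau>) u *v v)
        \<le> norm ((?B N - C (t - \<tau>) (?w N)) *v v) + norm ((C (t - \<tau>) (?w N) - C (t - \<tau>) u) *v v)"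
      using norm_triangle_ineq[of "(?B N - C (t - \<tau>) (?w N)) *v v"
          "(C (t - \<tau>) (?w N) - C (t - \<tau>) u) *v v"]
      by (simp add: matrix_vector_mult_diff_rdistrib)
    ultimately show ?case
      using norm_matrix_vector_le_spectral_norm[of "?B N - C (t - \<tau>) (?w N)" v]
        norm_matrix_vector_le_spectral_norm[of "C (t - \<tau>) (?w N) - C (t - \<tau>) u" v]
      by (smt (verit) distrib_right mult_right_mono norm_ge_zero)
  qed
  moreover have "?b \<longlonglongrightarrow> 0"
  proof -
    \<comment> \<open>The lag is fixed, so \<open>2 / ?c\<close> is a positive constant and the
      minimum tends to 0.\<close>
    have "(\<lambda>N. min (1 / real N) (2 / ?c)) \<longlonglongrightarrow> min 0 (2 / ?c)"
      by (intro tendsto_min tendsto_const lim_1_over_n)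
    moreover have "min 0 (2 / ?c) = 0"
      by (simp add: vlag_def)
    ultimately have "?b \<longlonglongrightarrow> (K / ?c powr (\<kappa> - 1) * 0 + K * \<bar>u - u\<bar> * ?c powr (- \<kappa>)) * norm v"
      by (intro tendsto_intros tendsto_shifted_rescaled_index) simp
    then show ?thesis
      by simp
  qed
  ultimately show "(\<lambda>N. ?B N *v v - C (t - \<tau>) u *v v) \<longlonglongrightarrow> 0"
    by (rule Lim_null_comparison)
qed

text \<open>From \<open>N0\<close> on, every translated section of the \<open>N\<close>-th
  covariance matrix obeys both bounds, and non-strict inequalities survive the entrywise limit of
  these finite sums.\<close>

lemma locally_stationary_section_bounds:
  fixes C :: "int \<Rightarrow> real \<Rightarrow> real ^ 'p ^ 'p"
  assumes ls: "locally_stationary M X K \<kappa> lam_inf lam_sup C" and S: "finite S"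
  shows "lam_inf * (\<Sum>t\<in>S. (norm (x t))\<^sup>2) \<le> (\<Sum>t\<in>S. \<Sum>\<tau>\<in>S. x t \<bullet> (C (t - \<tau>) u *v x \<tau>))"
    and "(\<Sum>t\<in>S. \<Sum>\<tau>\<in>S. x t \<bullet> (C (t - \<tau>) u *v x \<tau>)) \<le> lam_sup * (\<Sum>t\<in>S. (norm (x t))\<^sup>2)"
proof -
  let ?s = "\<lambda>N. \<lfloor>u * real N\<rfloor>"
  let ?f = "\<lambda>N. \<Sum>t\<in>S. \<Sum>\<tau>\<in>S. x t \<bullet> (cov_block M X N (t + ?s N) (\<tau> + ?s N) *v x \<tau>)"
  obtain N0 where
    N0: "ereal lam_inf \<le> (INF N\<in>{N0..}. lambda_inf (cov_block M X N))"
      "(SUP N\<in>{N0..}. lambda_sup (cov_block M X N)) \<le> ereal lam_sup"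
    using ls unfolding locally_stationary_def by blast
  have *: "ereal lam_inf \<le> lambda_inf (cov_block M X N)"
    "lambda_sup (cov_block M X N) \<le> ereal lam_sup" if "N \<ge> N0" for N
    using N0 that by (auto simp: le_INF_iff SUP_le_iff)
  have f: "?f \<longlonglongrightarrow> (\<Sum>t\<in>S. \<Sum>\<tau>\<in>S. x t \<bullet> (C (t - \<tau>) u *v x \<tau>))"
    by (intro tendsto_sum tendsto_inner tendsto_const locally_stationary_tendsto[OF ls])
  show "lam_inf * (\<Sum>t\<in>S. (norm (x t))\<^sup>2) \<le> (\<Sum>t\<in>S. \<Sum>\<tau>\<in>S. x t \<bullet> (C (t - \<tau>) u *v x \<tau>))"
    by (rule LIMSEQ_le_const[OF f]) (use translated_section_bounds(1)[OF *(1) *(2) S] in blast)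
  show "(\<Sum>t\<in>S. \<Sum>\<tau>\<in>S. x t \<bullet> (C (t - \<tau>) u *v x \<tau>)) \<le> lam_sup * (\<Sum>t\<in>S. (norm (x t))\<^sup>2)"
    by (rule LIMSEQ_le_const2[OF f]) (use translated_section_bounds(2)[OF *(1) *(2) S] in blast)
qed

section \<open>Positive definiteness and spectral bounds of the limiting Toeplitz matrices\<close>

theorem theorem3p1:
  fixes M :: "nat \<Rightarrow> 'w measure"
    and X :: "int \<Rightarrow> nat \<Rightarrow> 'w \<Rightarrow> real ^ 'p"
    and K \<kappa> lam_inf lam_sup :: real
    and C :: "int \<Rightarrow> real \<Rightarrow> real ^ 'p ^ 'p"
  assumes "time_series_array M X"
    and "locally_stationary M X K \<kappa> lam_inf lam_sup C"
  shows "\<forall>u :: real.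
           positive_definite_sequence (\<lambda>r. C r u) \<and>
           ereal lam_inf \<le> lambda_inf (block_toeplitz (\<lambda>r. C r u)) \<and>
           lambda_inf (block_toeplitz (\<lambda>r. C r u)) \<le> lambda_sup (block_toeplitz (\<lambda>r. C r u)) \<and>
           lambda_sup (block_toeplitz (\<lambda>r. C r u)) \<le> ereal lam_sup"
proof (intro allI conjI)
  fix u :: real
  note ls = assms(2)
  have \<kappa>: "\<kappa> > 3" and pos: "lam_inf > 0"
    and sym: "\<forall>r u. C r u = transpose (C (- r) u)"
    and bound: "\<forall>r. (SUP u. ereal (spectral_norm (C r u))) \<le> ereal (K * vlag r powr (- \<kappa>))"
    using ls unfolding locally_stationary_def by blast+
  note section_bounds = locally_stationary_section_bounds[OF ls]
  show "positive_definite_sequence (\<lambda>r. C r u)"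
    unfolding positive_definite_sequence_def
  proof (intro conjI allI impI)
    show "C (- r) u = transpose (C r u)" for r
      using sym[rule_format, of "- r" u] by simp
  next
    fix S and x :: "int \<Rightarrow> real ^ 'p"
    assume S: "finite S" "\<exists>t\<in>S. x t \<noteq> 0"
    then obtain t where "t \<in> S" "x t \<noteq> 0"
      by blast
    \<comment> \<open>Strictness is not lost in the limit: the lower bound is
      \<open>lam_inf\<close>, which is positive, times a squared norm that is positive because
      \<open>x t\<close> is nonzero.\<close>
    with S(1) have "(\<Sum>t\<in>S. (norm (x t))\<^sup>2) > 0"
      by (intro sum_pos2[of S t]) auto
    with pos have "lam_inf * (\<Sum>t\<in>S. (norm (x t))\<^sup>2) > 0"
      by simp
    also note section_bounds(1)[OF S(1)]
    finally show "(\<Sum>t\<in>S. \<Sum>\<tau>\<in>S. x t \<bullet> (C (t - \<tau>) u *v x \<tau>)) > 0" .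
  qed
  \<comment> \<open>The decay bound on \<open>C r u\<close>, uniform in \<open>u\<close>, supplies
    the summable function of the lag that dominates the blocks.\<close>
  let ?k = "\<lambda>r. K * vlag r powr (- \<kappa>)"
  have k: "?k summable_on UNIV"
    using \<kappa> by (intro summable_on_cmult_right summable_on_vlag_powr) simp
  have A: "norm (block_toeplitz (\<lambda>r. C r u) t \<tau> *v v) \<le> ?k (t - \<tau>) * norm v" for t \<tau> v
  proof -
    have "spectral_norm (C (t - \<tau>) u) \<le> ?k (t - \<tau>)"
      using bound by (simp add: SUP_le_iff)
    then have "spectral_norm (C (t - \<tau>) u) * norm v \<le> ?k (t - \<tau>) * norm v"
      by (intro mult_right_mono) auto
    then show ?thesis
      using norm_matrix_vector_le_spectral_norm[of "C (t - \<tau>) u" v]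
      unfolding block_toeplitz_def by linarith
  qed
  show "ereal lam_inf \<le> lambda_inf (block_toeplitz (\<lambda>r. C r u))"
    \<comment> \<open>Each conclusion mentions one constant only; the one from the opposite bound is
      supplied explicitly.\<close>
    by (rule lambda_bounds_of_finite_sections(1)[OF k, where m = lam_sup])
      (use A section_bounds in \<open>auto simp: block_toeplitz_def\<close>)
  show "lambda_sup (block_toeplitz (\<lambda>r. C r u)) \<le> ereal lam_sup"
    by (rule lambda_bounds_of_finite_sections(2)[OF k, where l = lam_inf])
      (use A section_bounds in \<open>auto simp: block_toeplitz_def\<close>)
  show "lambda_inf (block_toeplitz (\<lambda>r. C r u)) \<le> lambda_sup (block_toeplitz (\<lambda>r. C r u))"
    by (rule lambda_inf_le_lambda_sup)
qed

end
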